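(* Let $H=H(n,r,q\mid\sigma)$ be a $\sigma$-hypergraph, where $\sigma$ is a partition of $r$ with $s=s(\sigma)\ge 2$ parts. If $q\ge r(r-1)$ and $n\ge s+1$, then $H$ has a sharp Hamiltonian cycle.
   Context: Let $\sigma=(a_1,\ldots,a_s)$ be a partition of the positive integer $r$ into $s=s(\sigma)$ positive parts, with largest part $\Delta$. The $\sigma$-hypergraph $H(n,r,q\mid\sigma)$ is the $r$-uniform hypergraph whose $nq$ vertices are partitioned into $n$ classes $V_1,\ldots,V_n$ of $q$ vertices each, and in which an $r$-subset $K$ of the vertices is an edge if and only if the multiset of non-zero cardinalities $|K\cap V_i|$, $1\le i\le n$, is the partition $\sigma$ of $r$. It is always assumed that $q\ge\Delta$ and $n\ge s$. A sequence $C=(e_1,\ldots,e_p)$ of edges of an $r$-uniform hypergraph $H$ is a sharp cycle if $|e_i\cap e_{i+1}|>0$ for $1\le i\le p$, with indices modulo $p$, and $|e_i\cap e_j|=0$ for all other pairs of distinct indices $i,j$. Write $V(C)=e_1\cup\cdots\cup e_p$. A sharp cycle $C$ is a sharp Hamiltonian cycle if $V(C)=V(H)$. *)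

theory Defs
  imports Main "HOL-Library.Multiset"
begin

record 'a hypergraph =
  verts :: "'a set"
  edges :: "'a set set"

definition partition_of :: "nat \<Rightarrow> nat multiset \<Rightarrow> bool" where
  "partition_of r \<sigma> \<longleftrightarrow> r > 0 \<and> (\<forall>a \<in># \<sigma>. a > 0) \<and> sum_mset \<sigma> = r"

definition num_parts :: "nat multiset \<Rightarrow> nat" where
  "num_parts \<sigma> = size \<sigma>"

definition largest_part :: "nat multiset \<Rightarrow> nat" where
  "largest_part \<sigma> = Max (set_mset \<sigma>)"

text \<open>The vertices are the pairs (i, j) with i < n and j < q; the classes are indexed from 0.\<close>

definition vclass :: "nat \<Rightarrow> nat \<Rightarrow> (nat \<times> nat) set" where
  "vclass q i = {i} \<times> {..<q}"

definition intersection_type :: "nat \<Rightarrow> nat \<Rightarrow> (nat \<times> nat) set \<Rightarrow> nat multiset" where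
  "intersection_type n q K =
     filter_mset (\<lambda>c. c \<noteq> 0) (image_mset (\<lambda>i. card (K \<inter> vclass q i)) (mset_set {..<n}))"

definition sigma_hypergraph ::
  "nat \<Rightarrow> nat \<Rightarrow> nat \<Rightarrow> nat multiset \<Rightarrow> (nat \<times> nat) hypergraph" where
  "sigma_hypergraph n r q \<sigma> =
     \<lparr> verts = (\<Union>i<n. vclass q i),
       edges = {K. K \<subseteq> (\<Union>i<n. vclass q i) \<and> card K = r \<and> intersection_type n q K = \<sigma>} \<rparr>"

text \<open>The sequence of edges is a nonempty list, with indices starting at 0 and read modulo its
  length. No lower bound on the length is imposed, and the edges are not required to be distinct.
  When the length is at least 4, distinctness follows from the intersection conditions.\<close>

definition sharp_cycle :: "'a hypergraph \<Rightarrow> 'a set list \<Rightarrow> bool" where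
  "sharp_cycle H C \<longleftrightarrow>
     C \<noteq> [] \<and> set C \<subseteq> edges H \<and>
     (\<forall>i < length C. C ! i \<inter> C ! (Suc i mod length C) \<noteq> {}) \<and>
     (\<forall>i < length C. \<forall>j < length C.
        i \<noteq> j \<and> j \<noteq> Suc i mod length C \<and> i \<noteq> Suc j mod length C \<longrightarrow> C ! i \<inter> C ! j = {})"

definition cycle_verts :: "'a set list \<Rightarrow> 'a set" where
  "cycle_verts C = \<Union> (set C)"

definition sharp_hamiltonian_cycle :: "'a hypergraph \<Rightarrow> 'a set list \<Rightarrow> bool" where
  "sharp_hamiltonian_cycle H C \<longleftrightarrow> sharp_cycle H C \<and> cycle_verts C = verts H"

end

theory Submission
  imports Defs "HOL-Combinatorics.Transposition"
begin

text \<open>Up to the choice of vertices inside the classes, a sharp cycle \<open>e\<^sub>0, \<dots>, e\<^sub>p\<^sub>-\<^sub>1\<close> is given by the numbers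
  \<open>E u c = |e\<^sub>u \<inter> V\<^sub>c|\<close> and \<open>x u c = |e\<^sub>u \<inter> e\<^sub>u\<^sub>+\<^sub>1 \<inter> V\<^sub>c|\<close>. Place the parts of \<open>\<sigma>\<close> on the cyclic group of
  order \<open>n\<close> and let the edges be successive rotations of this pattern, consecutive edges sharing one
  vertex: \<open>k\<close> full turns cover \<open>k (r - 1)\<close> vertices of each class. Write \<open>q = k (r - 1) - d\<close> with
  \<open>d < r - 1\<close>; the bound on \<open>q\<close> gives \<open>k \<ge> r\<close>. If all parts are at least 2, the defect \<open>d\<close> is absorbed by
  letting consecutive edges share two vertices during \<open>d\<close> turns. If some part is 1, the defect is
  absorbed at \<open>n\<close> pairwise non-consecutive edges, one for each residue of the index modulo \<open>n\<close>, each of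
  which is replaced by one that shares \<open>d + 1 \<le> r - 1\<close> vertices with its successor.\<close>

subsection \<open>From intersection numbers to sharp Hamiltonian cycles\<close>

lemma Suc_mod_inj:
  assumes "i < p" "j < p" "Suc i mod p = Suc j mod p"
  shows "i = j"
  using assms by (auto simp: mod_Suc split: if_splits)

text \<open>\<open>B u\<close> is what edge \<open>u\<close> owns and \<open>J u\<close> is what it
  borrows from its successor. As the blocks are disjoint, two edges can meet only if their indices
  are equal or cyclically adjacent.\<close>

lemma sharp_cycle_of_blocks:
  assumes "p > 0"
    and edge: "\<And>u. u < p \<Longrightarrow> J u \<union> B u \<in> edges H"
    and sub: "\<And>u. u < p \<Longrightarrow> J u \<subseteq> B (Suc u mod p)"
    and ne: "\<And>u. u < p \<Longrightarrow> J u \<noteq> {}"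
    and disj: "\<And>u v. \<lbrakk>u < p; v < p; u \<noteq> v\<rbrakk> \<Longrightarrow> B u \<inter> B v = {}"
    and cover: "(\<Union>u<p. B u) = verts H"
  shows "sharp_hamiltonian_cycle H (map (\<lambda>u. J u \<union> B u) [0..<p])"
proof -
  have lt: "Suc u mod p < p" for u using \<open>p > 0\<close> by simp
  have meet: "(J u \<union> B u) \<inter> (J (Suc u mod p) \<union> B (Suc u mod p)) \<noteq> {}" if "u < p" for u
    using sub[OF that] ne[OF that] by blast
  have apart: "(J i \<union> B i) \<inter> (J j \<union> B j) = {}"
    if "i < p" "j < p" "i \<noteq> j" "j \<noteq> Suc i mod p" "i \<noteq> Suc j mod p" for i j
  proof -
    have "Suc i mod p \<noteq> Suc j mod p" using Suc_mod_inj that by blast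
    then have "B (Suc i mod p) \<inter> B (Suc j mod p) = {}" "B (Suc i mod p) \<inter> B j = {}"
      "B i \<inter> B (Suc j mod p) = {}" "B i \<inter> B j = {}"
      using disj that lt by auto
    then show ?thesis using sub[OF that(1)] sub[OF that(2)] by blast
  qed
  have "(\<Union>u<p. J u \<union> B u) = (\<Union>u<p. B u)" using sub lt by blast
  then show ?thesis
    using \<open>p > 0\<close> edge meet apart cover lt
    by (auto simp: sharp_hamiltonian_cycle_def sharp_cycle_def cycle_verts_def atLeast0LessThan)
qed

text \<open>Makes the size condition on an edge a consequence of its type; dropping zero counts does
  not change the sum.\<close>

lemma card_eq_sum_intersection_type:
  assumes "K \<subseteq> (\<Union>i<n. vclass q i)"
  shows "card K = sum_mset (intersection_type n q K)"
proof -
  have fin: "finite (vclass q i)" for i by (simp add: vclass_def)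
  have "K = (\<Union>i<n. K \<inter> vclass q i)" using assms by blast
  then have "card K = card (\<Union>i\<in>{..<n}. K \<inter> vclass q i)" by simp
  also have "\<dots> = (\<Sum>i<n. card (K \<inter> vclass q i))"
    by (rule card_UN_disjoint) (auto simp: fin, auto simp: vclass_def)
  also have "\<dots> = sum_mset (image_mset (\<lambda>i. card (K \<inter> vclass q i)) (mset_set {..<n}))"
    by (simp add: sum_unfold_sum_mset)
  also have "\<dots> = sum_mset (intersection_type n q K)"
  proof -
    have "sum_mset M = sum_mset (filter_mset (\<lambda>c. c \<noteq> 0) M)" for M :: "nat multiset"
      by (induction M) auto
    then show ?thesis unfolding intersection_type_def by blast
  qed
  finally show ?thesis .
qed

lemma ex_block:
  fixes y :: "nat \<Rightarrow> nat"
  assumes "v < (\<Sum>l<m. y l)"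
  shows "\<exists>u<m. (\<Sum>l<u. y l) \<le> v \<and> v < (\<Sum>l<Suc u. y l)"
  using assms
proof (induction m)
  case (Suc m)
  then show ?case by (cases "v < (\<Sum>l<m. y l)") (auto intro: less_SucI)
qed simp

text \<open>In class \<open>c\<close>, edge \<open>u\<close> owns an interval of length
  \<open>E u c - x u c\<close> and borrows the first \<open>x u c\<close> vertices of the next
  edge's interval. \<open>le_Suc\<close> makes that interval long enough, and \<open>total\<close>
  makes the intervals fill the class exactly.\<close>

lemma sharp_hamiltonian_cycle_of_counts:
  fixes E x :: "nat \<Rightarrow> nat \<Rightarrow> nat"
  assumes "p \<ge> 2" "sum_mset \<sigma> = r"
    and type: "\<And>u. u < p \<Longrightarrow>
      filter_mset (\<lambda>m. m \<noteq> 0) (image_mset (E u) (mset_set {..<n})) = \<sigma>"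
    and le: "\<And>u c. \<lbrakk>u < p; c < n\<rbrakk> \<Longrightarrow> x u c \<le> E u c"
    and le_Suc: "\<And>u c. \<lbrakk>u < p; c < n\<rbrakk> \<Longrightarrow> x u c + x (Suc u mod p) c \<le> E (Suc u mod p) c"
    and pos: "\<And>u. u < p \<Longrightarrow> \<exists>c<n. x u c > 0"
    and total: "\<And>c. c < n \<Longrightarrow> (\<Sum>u<p. E u c) = q + (\<Sum>u<p. x u c)"
  shows "\<exists>C. sharp_hamiltonian_cycle (sigma_hypergraph n r q \<sigma>) C"
proof -
  define y where "y u c = E u c - x u c" for u c
  define P where "P u c = (\<Sum>l<u. y l c)" for u c
  define B where "B u = (SIGMA c:{..<n}. {P u c..<P (Suc u) c})" for u
  \<comment> \<open>For \<open>u = p - 1\<close> the start is \<open>P 0 c = 0\<close>: the last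
    edge borrows from the first block.\<close>
  define J where "J u = (SIGMA c:{..<n}. {P (Suc u mod p) c..<P (Suc u mod p) c + x u c})" for u
  have lt: "Suc u mod p < p" for u using \<open>p \<ge> 2\<close> by simp
  have P_Suc: "P (Suc u) c = P u c + y u c" for u c by (simp add: P_def)
  have P_mono: "P u c \<le> P v c" if "u \<le> v" for u v c
    unfolding P_def by (rule sum_mono2) (use that in auto)
  have P_p: "P p c = q" if "c < n" for c
  proof -
    have "P p c + (\<Sum>u<p. x u c) = (\<Sum>u<p. y u c + x u c)" by (simp add: P_def sum.distrib)
    also have "\<dots> = (\<Sum>u<p. E u c)" by (rule sum.cong) (auto simp: y_def le that)
    finally show ?thesis using total[OF that] by simp
  qed
  have B_sub: "B u \<subseteq> (\<Union>i<n. vclass q i)" if "u < p" for u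
  proof
    fix z assume "z \<in> B u"
    then obtain c v where z: "z = (c, v)" "c < n" "v < P (Suc u) c" by (auto simp: B_def)
    then have "v < q" using P_mono[of "Suc u" p c] P_p[of c] that by auto
    then show "z \<in> (\<Union>i<n. vclass q i)" using z by (auto simp: vclass_def)
  qed
  have sub: "J u \<subseteq> B (Suc u mod p)" if "u < p" for u
    using le_Suc[OF that] by (fastforce simp: J_def B_def P_Suc y_def)
  have disj: "B u \<inter> B v = {}" if "u \<noteq> v" for u v
    using that
  proof (induction u v rule: linorder_wlog)
    case (le u v)
    then have "P (Suc u) c \<le> P v c" for c using P_mono by simp
    then show ?case by (auto simp: B_def) (meson leD le_less_trans)
  qed (simp add: Int_commute)
  have cover: "(\<Union>u<p. B u) = (\<Union>i<n. vclass q i)"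
  proof
    show "(\<Union>i<n. vclass q i) \<subseteq> (\<Union>u<p. B u)"
    proof
      fix z assume "z \<in> (\<Union>i<n. vclass q i)"
      then obtain c v where z: "z = (c, v)" "c < n" "v < q" by (auto simp: vclass_def)
      then have "v < (\<Sum>l<p. y l c)" using P_p[of c] by (simp add: P_def)
      from ex_block[OF this] show "z \<in> (\<Union>u<p. B u)" using z by (auto simp: B_def P_def)
    qed
  qed (use B_sub in blast)
  have card: "card ((J u \<union> B u) \<inter> vclass q c) = E u c" if "u < p" "c < n" for u c
  proof -
    \<comment> \<open>With \<open>p \<ge> 2\<close> the successor's block is another one, so owned
      and borrowed vertices are disjoint and their numbers add up.\<close>
    have "Suc u mod p \<noteq> u" using that \<open>p \<ge> 2\<close> by (auto simp: mod_Suc)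
    then have dis: "J u \<inter> B u = {}" using disj sub that by blast
    have full: "J u \<union> B u \<subseteq> (\<Union>i<n. vclass q i)" using sub B_sub lt that by blast
    have "(J u \<union> B u) \<inter> vclass q c = (J u \<union> B u) \<inter> ({c} \<times> UNIV)"
      using full by (auto simp: vclass_def)
    also have "\<dots> = J u \<inter> ({c} \<times> UNIV) \<union> B u \<inter> ({c} \<times> UNIV)" by blast
    also have "J u \<inter> ({c} \<times> UNIV) = {c} \<times> {P (Suc u mod p) c..<P (Suc u mod p) c + x u c}"
      using that by (auto simp: J_def)
    also have "B u \<inter> ({c} \<times> UNIV) = {c} \<times> {P u c..<P (Suc u) c}"
      using that by (auto simp: B_def)
    also have "card (({c} \<times> {P (Suc u mod p) c..<P (Suc u mod p) c + x u c}) \<union>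
        {c} \<times> {P u c..<P (Suc u) c})
       = x u c + y u c"
      using dis that by (subst card_Un_disjoint) (auto simp: J_def B_def P_Suc)
    finally show ?thesis using le[OF that] by (simp add: y_def)
  qed
  have edge: "J u \<union> B u \<in> edges (sigma_hypergraph n r q \<sigma>)" if "u < p" for u
  proof -
    have full: "J u \<union> B u \<subseteq> (\<Union>i<n. vclass q i)" using sub B_sub lt that by blast
    have "intersection_type n q (J u \<union> B u) = \<sigma>"
      unfolding type[OF that, symmetric] intersection_type_def
      by (intro arg_cong[of _ _ "filter_mset _"] image_mset_cong) (simp add: card that)
    then show ?thesis
      using full card_eq_sum_intersection_type[OF full] \<open>sum_mset \<sigma> = r\<close>
      by (simp add: sigma_hypergraph_def)
  qed
  have "sharp_hamiltonian_cycle (sigma_hypergraph n r q \<sigma>) (map (\<lambda>u. J u \<union> B u) [0..<p])"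
  proof (rule sharp_cycle_of_blocks)
    show "J u \<noteq> {}" if "u < p" for u
      using pos[OF that] by (fastforce simp: J_def)
    show "(\<Union>u<p. B u) = verts (sigma_hypergraph n r q \<sigma>)"
      using cover by (simp add: sigma_hypergraph_def)
  qed (use \<open>p \<ge> 2\<close> edge sub disj in auto)
  then show ?thesis ..
qed

subsection \<open>Rotating a pattern\<close>

lemma bij_betw_add_mod:
  fixes n u :: nat
  shows "bij_betw (\<lambda>c. (u + c) mod n) {..<n} {..<n}"
proof -
  have "b \<in> (\<lambda>c. (u + c) mod n) ` {..<n}" if "b < n" for b
  proof (rule image_eqI)
    have "(u + (b + (n - u mod n)) mod n) mod n = (u mod n + (b + (n - u mod n))) mod n"
      by (simp add: mod_simps)
    also have "u mod n + (b + (n - u mod n)) = b + n"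
      using mod_less_divisor[of n u] that by linarith
    finally show "b = (u + (b + (n - u mod n)) mod n) mod n" using that by simp
  qed (use that in simp)
  then have "(\<lambda>c. (u + c) mod n) ` {..<n} = {..<n}" by auto
  then show ?thesis by (simp add: bij_betw_def eq_card_imp_inj_on)
qed

lemma ex_add_mod_eq:
  fixes n u j :: nat
  assumes "j < n"
  shows "\<exists>c<n. (u + c) mod n = j"
  using bij_betw_imp_surj_on[OF bij_betw_add_mod[of u n]] assms
  by (metis (no_types, lifting) imageE lessThan_iff)

lemma sum_residues:
  fixes f :: "nat \<Rightarrow> nat"
  assumes "bij_betw (\<lambda>u. u mod n) U {..<n}"
  shows "(\<Sum>u\<in>U. f ((u + a) mod n)) = (\<Sum>j<n. f j)"
proof -
  have "bij_betw ((\<lambda>c. (a + c) mod n) \<circ> (\<lambda>u. u mod n)) U {..<n}"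
    by (rule bij_betw_trans[OF assms bij_betw_add_mod])
  from sum.reindex_bij_betw[OF this, of f] show ?thesis
    by (simp add: mod_simps add.commute)
qed

lemma sum_rotations:
  fixes f :: "nat \<Rightarrow> nat"
  shows "(\<Sum>u<k * n. f ((u + a) mod n)) = k * (\<Sum>j<n. f j)"
proof (induction k)
  case (Suc k)
  have "{..<Suc k * n} = {..<k * n} \<union> {k * n..<k * n + n}" by auto
  then have "(\<Sum>u<Suc k * n. f ((u + a) mod n)) =
      (\<Sum>u<k * n. f ((u + a) mod n)) + (\<Sum>u=k * n..<k * n + n. f ((u + a) mod n))"
    by (simp add: sum.union_disjoint ivl_disj_int)
  also have "(\<Sum>u=k * n..<k * n + n. f ((u + a) mod n)) = (\<Sum>u<n. f ((u + a) mod n))"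
    by (simp add: sum.atLeastLessThan_shift_0[of _ "k * n"] atLeast0LessThan add.assoc)
  also have "\<dots> = (\<Sum>j<n. f j)"
    by (rule sum_residues) (auto simp: bij_betw_def inj_on_def)
  finally show ?case using Suc.IH by simp
qed simp

text \<open>On the transversal \<open>U\<close> the pattern \<open>f\<close> makes one turn in place
  of one of the \<open>k\<close> turns of \<open>g\<close>. The extra sum on the left avoids
  \<open>k - 1\<close>.\<close>

lemma sum_rotations_split:
  fixes f g :: "nat \<Rightarrow> nat"
  assumes "bij_betw (\<lambda>u. u mod n) U {..<n}" "U \<subseteq> {..<k * n}"
  shows "(\<Sum>u<k * n. if u \<in> U then f ((u + a) mod n) else g ((u + b) mod n)) + (\<Sum>j<n. g j)
    = (\<Sum>j<n. f j) + k * (\<Sum>j<n. g j)"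
proof -
  have *: "(\<Sum>u<k * n. h u) = sum h U + sum h ({..<k * n} - U)" for h :: "nat \<Rightarrow> nat"
    using assms(2) by (simp add: sum.subset_diff add.commute)
  have "sum (\<lambda>u. g ((u + b) mod n)) ({..<k * n} - U) + (\<Sum>j<n. g j) = k * (\<Sum>j<n. g j)"
    using *[of "\<lambda>u. g ((u + b) mod n)"] by (simp add: sum_rotations sum_residues[OF assms(1)])
  moreover have "(\<Sum>u<k * n. if u \<in> U then f ((u + a) mod n) else g ((u + b) mod n))
    = (\<Sum>j<n. f j) + sum (\<lambda>u. g ((u + b) mod n)) ({..<k * n} - U)"
    unfolding *[of "\<lambda>u. if u \<in> U then f ((u + a) mod n) else g ((u + b) mod n)"]
    by (simp add: sum_residues[OF assms(1)])
  ultimately show ?thesis by simp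
qed

lemma image_mset_rotate:
  fixes n u :: nat
  shows "image_mset (\<lambda>c. f ((u + c) mod n)) (mset_set {..<n}) = image_mset f (mset_set {..<n})"
proof -
  have "image_mset (\<lambda>c. (u + c) mod n) (mset_set {..<n}) = mset_set {..<n}"
    using bij_betw_add_mod[of u n] by (simp add: image_mset_mset_set bij_betw_def)
  then show ?thesis by (metis (no_types, lifting) multiset.map_comp comp_def image_mset_cong)
qed

text \<open>The class beyond the number of parts supplies the empty position 2, right after the two
  chosen parts.\<close>

lemma ex_pattern:
  fixes \<sigma> :: "nat multiset"
  assumes "\<sigma> = {#a, b#} + \<tau>" "n \<ge> size \<sigma> + 1" "0 \<notin># \<sigma>"
  obtains \<beta> :: "nat \<Rightarrow> nat" where "\<beta> 0 = a" "\<beta> 1 = b" "\<beta> 2 = 0"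
    "filter_mset (\<lambda>m. m \<noteq> 0) (image_mset \<beta> (mset_set {..<n})) = \<sigma>"
    "(\<Sum>j<n. \<beta> j) = sum_mset \<sigma>"
proof -
  obtain xs where xs: "mset xs = \<tau>" using ex_mset by blast
  define L where "L = [a, b, 0] @ xs @ replicate (n - size \<sigma> - 1) 0"
  have len: "length L = n" using assms xs by (auto simp: L_def)
  have nz: "filter_mset (\<lambda>m. m \<noteq> 0) \<tau> = \<tau>" "a \<noteq> 0" "b \<noteq> 0"
    using assms(1,3) by (auto simp: filter_mset_eq_conv intro!: gr0I)
  have "image_mset (nth L) (mset_set {..<n}) = mset L"
    unfolding len[symmetric]
    by (metis atLeast0LessThan map_nth mset_map mset_upt)
  moreover have "filter_mset (\<lambda>m. m \<noteq> 0) (mset L) = \<sigma>" "sum_mset (mset L) = sum_mset \<sigma>"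
    using nz by (auto simp: L_def assms(1) xs)
  ultimately show ?thesis
    by (intro that[of "nth L"]) (auto simp: L_def sum_unfold_sum_mset)
qed

text \<open>Greedy choice: the new point takes as much of \<open>t\<close> as fits, and the
  induction hypothesis distributes the rest.\<close>

lemma ex_subpattern:
  fixes \<beta> :: "'a \<Rightarrow> nat"
  assumes "finite A" "t \<le> sum \<beta> A"
  shows "\<exists>\<omega>. (\<forall>j\<in>A. \<omega> j \<le> \<beta> j) \<and> sum \<omega> A = t"
  using assms
proof (induction A arbitrary: t)
  case (insert a A)
  obtain \<omega> where \<omega>: "\<forall>j\<in>A. \<omega> j \<le> \<beta> j" "sum \<omega> A = t - \<beta> a"
  proof -
    have "t - \<beta> a \<le> sum \<beta> A" using insert.prems insert.hyps by simp
    from insert.IH[OF this] that show thesis by blast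
  qed
  have "sum (\<omega>(a := min t (\<beta> a))) A = sum \<omega> A"
    by (rule sum.cong) (use insert.hyps in auto)
  then show ?case using \<omega> insert.hyps by (intro exI[of _ "\<omega>(a := min t (\<beta> a))"]) auto
qed simp

lemma ex_nonconsecutive_residues:
  fixes n k :: nat
  assumes "k \<ge> 3" "n > 0"
  obtains U where "U \<subseteq> {..<k * n}" "bij_betw (\<lambda>u. u mod n) U {..<n}"
    "\<And>u. u \<in> U \<Longrightarrow> Suc u mod (k * n) \<notin> U"
proof -
  \<comment> \<open>Even residues come from the first turn, odd ones from the second. At the
    junction, \<open>n\<close> has the even offset 0 in the second turn and so is not in
    \<open>U\<close>.\<close>
  define h where "h j = (if even j then j else n + j)" for j
  define U where "U = h ` {..<n}"
  have kn: "3 * n \<le> k * n" using assms by simp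
  have mem: "v \<in> U \<longleftrightarrow> (v < n \<and> even v) \<or> (n \<le> v \<and> v < 2 * n \<and> odd (v - n))" for v
  proof
    assume "(v < n \<and> even v) \<or> (n \<le> v \<and> v < 2 * n \<and> odd (v - n))"
    then show "v \<in> U"
    proof
      assume "n \<le> v \<and> v < 2 * n \<and> odd (v - n)"
      then show ?thesis unfolding U_def by (intro image_eqI[of _ _ "v - n"]) (auto simp: h_def)
    qed (auto simp: U_def h_def intro!: image_eqI[of _ _ v])
  qed (auto simp: U_def h_def)
  show ?thesis
  proof (rule that[of "U"])
    show "U \<subseteq> {..<k * n}"
    proof
      fix v assume "v \<in> U"
      then have "v < 2 * n" by (auto simp: mem)
      then show "v \<in> {..<k * n}" using kn unfolding lessThan_iff by linarith
    qed
    show "bij_betw (\<lambda>u. u mod n) (U) {..<n}"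
      by (rule bij_betw_byWitness[where f' = h]) (auto simp: U_def h_def)
    fix u assume "u \<in> U"
    then have u: "(u < n \<and> even u) \<or> (n \<le> u \<and> u < 2 * n \<and> odd (u - n))" by (simp add: mem)
    \<comment> \<open>The third turn is free of \<open>U\<close>, so no successor wraps around to 0,
      which lies in \<open>U\<close>.\<close>
    then have "Suc u < k * n" using kn assms by linarith
    then show "Suc u mod (k * n) \<notin> U"
      using u by (cases "Suc u = n") (auto simp: mem Suc_diff_le)
  qed
qed

subsection \<open>The two constructions\<close>

text \<open>The number of edges is a multiple of \<open>n\<close>, so closing the cycle does not
  disturb the rotation.\<close>

lemma Suc_mod_mult_mod: "(Suc u mod (k * n) + c) mod n = (Suc u + c) mod n" for n :: nat
proof -
  have "Suc u mod (k * n) mod n = Suc u mod n" by (simp add: mod_mod_cancel)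
  then show ?thesis by (metis mod_add_left_eq)
qed

text \<open>The link at position 0 of an edge is at position 1 of the next edge. Each edge thus
  links forward at 0 and backward at 1, and both parts must hold the link.\<close>

lemma hamiltonian_by_double_links:
  fixes \<beta> :: "nat \<Rightarrow> nat"
  assumes "n \<ge> 2" "k \<ge> 1" "d \<le> k" "sum_mset \<sigma> = r" "q + (k + d) = k * r"
    and \<beta>: "filter_mset (\<lambda>m. m \<noteq> 0) (image_mset \<beta> (mset_set {..<n})) = \<sigma>" "(\<Sum>j<n. \<beta> j) = r"
    and ge: "\<beta> 0 \<ge> (if d = 0 then 1 else 2)" "\<beta> 1 \<ge> (if d = 0 then 1 else 2)"
  shows "\<exists>C. sharp_hamiltonian_cycle (sigma_hypergraph n r q \<sigma>) C"
proof -
  \<comment> \<open>Doubling the links during the first \<open>d\<close> turns raises the shared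
    total in each class from \<open>k\<close> to \<open>k + d\<close>.\<close>
  define w :: "nat \<Rightarrow> nat" where "w u = (if u < d * n then 2 else 1)" for u
  define x where "x u c = (if (u + c) mod n = 0 then w u else 0)" for u c
  define E where "E u c = \<beta> ((u + c) mod n)" for u c
  have w: "1 \<le> w u" "w u \<le> \<beta> 0" "w u \<le> \<beta> 1" for u
    using ge by (auto simp: w_def split: if_splits)
  have x_sum: "(\<Sum>u<k * n. x u c) = k + d" for c
  proof -
    define g :: "nat \<Rightarrow> nat" where "g j = (if j = 0 then 1 else 0)" for j
    have g: "(\<Sum>j<n. g j) = 1" using assms(1) by (simp add: g_def)
    have "(\<Sum>u<k * n. x u c) =
        (\<Sum>u<k * n. g ((u + c) mod n) + (if u < d * n then g ((u + c) mod n) else 0))"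
      by (rule sum.cong) (auto simp: x_def w_def g_def)
    also have "\<dots> = (\<Sum>u<k * n. g ((u + c) mod n)) +
        (\<Sum>u<k * n. if u < d * n then g ((u + c) mod n) else 0)"
      by (rule sum.distrib)
    also have "(\<Sum>u<k * n. if u < d * n then g ((u + c) mod n) else 0) = (\<Sum>u<d * n. g ((u + c) mod n))"
      using mult_le_mono1[OF \<open>d \<le> k\<close>, of n] by (intro sum.mono_neutral_cong_right) auto
    finally show ?thesis by (simp only: sum_rotations g)
  qed
  show ?thesis
  proof (rule sharp_hamiltonian_cycle_of_counts[where p = "k * n" and x = x and E = E])
    show "2 \<le> k * n" using assms(1,2) mult_le_mono[of 1 k 2 n] by simp
    show "filter_mset (\<lambda>m. m \<noteq> 0) (image_mset (E u) (mset_set {..<n})) = \<sigma>" for u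
      unfolding E_def image_mset_rotate by (rule \<beta>)
    show "x u c \<le> E u c" for u c using w by (auto simp: x_def E_def)
    show "x u c + x (Suc u mod (k * n)) c \<le> E (Suc u mod (k * n)) c" for u c
    proof -
      define o1 where "o1 = (Suc u mod (k * n) + c) mod n"
      have "o1 = (Suc u + c) mod n" unfolding o1_def by (rule Suc_mod_mult_mod)
      then have "(u + c) mod n = 0 \<longleftrightarrow> o1 = 1"
        using assms(1) by (auto simp: mod_Suc)
      then show ?thesis
        using w unfolding x_def E_def o1_def[symmetric] by auto
    qed
    show "\<exists>c<n. 0 < x u c" for u
      using ex_add_mod_eq[of 0 n u] w(1)[of u] assms(1) by (auto simp: x_def)
    show "(\<Sum>u<k * n. E u c) = q + (\<Sum>u<k * n. x u c)" for c
      using assms(5) by (simp add: E_def sum_rotations \<beta> x_sum)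
  qed fact
qed

text \<open>Trading one turn of single links for links of size \<open>d + 1\<close> raises the
  shared total in each class from \<open>k\<close> to \<open>k + d\<close>. Since \<open>U\<close>
  has no two consecutive indices, an altered edge has unaltered neighbours.\<close>

lemma hamiltonian_by_large_links:
  fixes \<beta> :: "nat \<Rightarrow> nat"
  assumes "n \<ge> 3" "k \<ge> 3" "d + 1 \<le> r - 1" "sum_mset \<sigma> = r" "q + (k + d) = k * r"
    and \<beta>: "filter_mset (\<lambda>m. m \<noteq> 0) (image_mset \<beta> (mset_set {..<n})) = \<sigma>" "(\<Sum>j<n. \<beta> j) = r"
      "\<beta> 0 = 1" "\<beta> 1 \<ge> 1" "\<beta> 2 = 0"
  shows "\<exists>C. sharp_hamiltonian_cycle (sigma_hypergraph n r q \<sigma>) C"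
proof -
  obtain U where U: "U \<subseteq> {..<k * n}" "bij_betw (\<lambda>u. u mod n) U {..<n}"
    "\<And>u. u \<in> U \<Longrightarrow> Suc u mod (k * n) \<notin> U"
    using ex_nonconsecutive_residues[of k n] assms(1,2) by auto
  have split0: "(\<Sum>j<n. f j) = f 0 + sum f {1..<n}" for f :: "nat \<Rightarrow> nat"
    using assms(1) by (simp add: lessThan_atLeast0 sum.atLeast_Suc_lessThan)
  \<comment> \<open>Position 0 stays reserved for the forward link of the next edge; the others hold
    \<open>r - 1 \<ge> d + 1\<close> vertices.\<close>
  obtain \<omega>' where \<omega>': "\<forall>j\<in>{1..<n}. \<omega>' j \<le> \<beta> j" "sum \<omega>' {1..<n} = d + 1"
    using ex_subpattern[of "{1..<n}" "d + 1" \<beta>] split0[of \<beta>] \<beta> assms(3) by auto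
  define \<omega> where "\<omega> = \<omega>'(0 := 0)"
  have \<omega>0: "\<omega> 0 = 0" by (simp add: \<omega>_def)
  have \<omega>_le: "\<omega> j \<le> \<beta> j" if "j < n" for j using \<omega>'(1) that by (auto simp: \<omega>_def)
  have \<omega>2: "\<omega> 2 = 0" using \<omega>_le[of 2] \<beta> assms(1) by simp
  have \<omega>_sum: "(\<Sum>j<n. \<omega> j) = d + 1"
    using \<omega>'(2) by (simp add: split0 \<omega>_def)
  text \<open>For \<open>u \<in> U\<close>, the edge \<open>e\<^sub>u\<close> copies \<open>e\<^sub>u\<^sub>+\<^sub>1\<close> except that the single vertex at position 0, which
    links \<open>e\<^sub>u\<^sub>+\<^sub>1\<close> to \<open>e\<^sub>u\<^sub>+\<^sub>2\<close>, is traded for one at the empty position 2, where \<open>e\<^sub>u\<^sub>-\<^sub>1\<close> has its link.\<close>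
  define \<gamma> where "\<gamma> = \<beta> \<circ> transpose 0 2"
  have \<gamma>: "\<gamma> j = (if j = 0 then 0 else if j = 2 then 1 else \<beta> j)" for j
    using \<beta> by (auto simp: \<gamma>_def transpose_def)
  have perm: "bij_betw (transpose 0 2) {..<n} {..<n}"
    using assms(1) by (intro bij_betw_byWitness[where f' = "transpose 0 2"]) (auto simp: transpose_def)
  have \<gamma>_mset: "image_mset \<gamma> (mset_set {..<n}) = image_mset \<beta> (mset_set {..<n})"
    unfolding \<gamma>_def multiset.map_comp[symmetric] using perm
    by (simp add: image_mset_mset_set bij_betw_def)
  have \<gamma>_sum: "(\<Sum>j<n. \<gamma> j) = r"
    using sum.reindex_bij_betw[OF perm, of \<beta>] \<beta> by (simp add: \<gamma>_def)
  have \<omega>\<gamma>: "\<omega> j \<le> \<gamma> j" if "j < n" for j using \<omega>_le[OF that] \<omega>0 \<omega>2 by (auto simp: \<gamma>)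
  define \<delta> :: "nat \<Rightarrow> nat" where "\<delta> j = (if j = 0 then 1 else 0)" for j
  have \<delta>_sum: "(\<Sum>j<n. \<delta> j) = 1" using assms(1) by (simp add: \<delta>_def)
  \<comment> \<open>For \<open>u \<in> U\<close> positions are read in the frame of the next edge,
    hence the shift by 1.\<close>
  define x where "x u c = (if u \<in> U then \<omega> ((u + (1 + c)) mod n) else \<delta> ((u + c) mod n))" for u c
  define E where "E u c = (if u \<in> U then \<gamma> ((u + (1 + c)) mod n) else \<beta> ((u + c) mod n))" for u c
  show ?thesis
  proof (rule sharp_hamiltonian_cycle_of_counts[where p = "k * n" and x = x and E = E])
    show "2 \<le> k * n" using assms(1,2) mult_le_mono[of 1 k 2 n] by simp
    show "filter_mset (\<lambda>m. m \<noteq> 0) (image_mset (E u) (mset_set {..<n})) = \<sigma>" for u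
      using image_mset_rotate[of \<gamma> "u + 1" n] image_mset_rotate[of \<beta> u n] \<gamma>_mset \<beta>(1)
      by (cases "u \<in> U") (simp_all add: E_def[abs_def])
    show "x u c \<le> E u c" for u c
      using \<omega>\<gamma> \<beta> assms(1) by (auto simp: x_def E_def \<delta>_def)
    show "x u c + x (Suc u mod (k * n)) c \<le> E (Suc u mod (k * n)) c" if "u < k * n" for u c
    proof -
      define v where "v = Suc u mod (k * n)"
      define o1 where "o1 = (v + c) mod n"
      have o1: "(u + (1 + c)) mod n = o1" "o1 < n"
        using assms(1) Suc_mod_mult_mod[of u k n c] by (auto simp: o1_def v_def)
      have o1': "(u + c) mod n = 0 \<longleftrightarrow> o1 = 1"
        using assms(1) unfolding o1(1)[symmetric] by (auto simp: mod_Suc)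
      have o2: "(v + (1 + c)) mod n = Suc o1 mod n" by (simp add: o1_def mod_Suc_eq)
      have o2': "Suc o1 mod n = 2 \<longleftrightarrow> o1 = 1"
        using assms(1) o1(2) by (auto simp: mod_Suc)
      have "\<omega> (Suc o1 mod n) \<le> \<gamma> (Suc o1 mod n)" using \<omega>\<gamma> assms(1) by simp
      moreover have "\<gamma> 2 = 1" by (simp add: \<gamma>)
      \<comment> \<open>If \<open>u \<in> U\<close>, then \<open>\<omega>\<close> avoids position 0,
        where \<open>v\<close> links forward. If \<open>v \<in> U\<close>, the incoming link is at
        position 2 of the shifted frame, where \<open>\<gamma>\<close> is 1 and
        \<open>\<omega>\<close> is 0. Otherwise the links sit at positions 1 and 0.\<close>
      ultimately have "x u c + x v c \<le> E v c"
        using U(3)[of u] \<omega>_le[OF o1(2)] \<omega>0 \<omega>2 \<beta> o1' o2'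
        unfolding x_def E_def o1 o2 o1_def[symmetric] \<delta>_def v_def[symmetric]
        by auto
      then show ?thesis by (simp add: v_def)
    qed
    show "\<exists>c<n. 0 < x u c" for u
    proof (cases "u \<in> U")
      case True
      obtain j where "j < n" "\<omega> j > 0"
        using \<omega>_sum by (metis (no_types, lifting) add_is_0 gr0I lessThan_iff one_neq_zero sum.neutral)
      then show ?thesis using ex_add_mod_eq[of j n "u + 1"] True by (auto simp: x_def)
    next
      case False
      then show ?thesis using ex_add_mod_eq[of 0 n u] assms(1) by (auto simp: x_def \<delta>_def)
    qed
    show "(\<Sum>u<k * n. E u c) = q + (\<Sum>u<k * n. x u c)" for c
      using sum_rotations_split[OF U(2,1), of \<gamma> "1 + c" \<beta> c]
        sum_rotations_split[OF U(2,1), of \<omega> "1 + c" \<delta> c] assms(5)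
      unfolding E_def x_def \<gamma>_sum \<beta>(2) \<omega>_sum \<delta>_sum by linarith
  qed fact
qed

section \<open>Number of turns, defect and choice of construction\<close>

theorem theorem3p6:
  fixes n r q :: nat and \<sigma> :: "nat multiset"
  assumes "partition_of r \<sigma>"
    and "q \<ge> largest_part \<sigma>"
    and "n \<ge> num_parts \<sigma>"
    and "num_parts \<sigma> \<ge> 2"
    and "q \<ge> r * (r - 1)"
    and "n \<ge> num_parts \<sigma> + 1"
  shows "\<exists>C. sharp_hamiltonian_cycle (sigma_hypergraph n r q \<sigma>) C"
proof -
  have sum: "sum_mset \<sigma> = r" and nz: "0 \<notin># \<sigma>"
    using assms(1) by (auto simp: partition_of_def)
  have size: "size \<sigma> \<ge> 2" "n \<ge> size \<sigma> + 1" using assms(4,6) by (auto simp: num_parts_def)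
  \<comment> \<open>A part 1, if there is one, goes to position 0, as the large links
    require.\<close>
  obtain a where a: "a \<in># \<sigma>" "1 \<in># \<sigma> \<longrightarrow> a = 1"
    using size(1) by (metis multiset_nonemptyE size_empty not_numeral_le_zero)
  then obtain \<sigma>' where \<sigma>': "\<sigma> = add_mset a \<sigma>'" by (metis multi_member_split)
  then obtain b \<tau> where "\<sigma>' = add_mset b \<tau>" using size(1) by (cases \<sigma>') auto
  with \<sigma>' have \<sigma>: "\<sigma> = {#a, b#} + \<tau>" by simp
  obtain \<beta> :: "nat \<Rightarrow> nat" where \<beta>: "\<beta> 0 = a" "\<beta> 1 = b" "\<beta> 2 = 0"
    "filter_mset (\<lambda>m. m \<noteq> 0) (image_mset \<beta> (mset_set {..<n})) = \<sigma>"
    "(\<Sum>j<n. \<beta> j) = r"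
    using ex_pattern[OF \<sigma> size(2) nz] sum by metis
  have ab: "a \<ge> 1" "b \<ge> 1" using nz \<sigma> by (auto simp: Suc_le_eq)
  then have r: "r \<ge> 2" using sum \<sigma> by auto
  \<comment> \<open>\<open>k\<close> is \<open>q / (r - 1)\<close> rounded up, and \<open>d\<close>
    is the excess \<open>k * (r - 1) - q\<close>.\<close>
  define k where "k = (q + (r - 2)) div (r - 1)"
  define d where "d = r - 2 - (q + (r - 2)) mod (r - 1)"
  have "(q + (r - 2)) mod (r - 1) < r - 1" using r by simp
  then have "(q + (r - 2)) mod (r - 1) \<le> r - 2" by linarith
  then have "(q + (r - 2)) mod (r - 1) + d = r - 2"
    unfolding d_def by (rule le_add_diff_inverse)
  then have kd: "q + d = k * (r - 1)"
    using div_mult_mod_eq[of "q + (r - 2)" "r - 1"] unfolding k_def by linarith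
  have "d \<le> r - 2" by (simp add: d_def)
  have "k * r = k * (r - 1) + k" using r by (cases r) auto
  with kd have total: "q + (k + d) = k * r" by simp
  have "r * (r - 1) \<le> k * (r - 1)" using kd assms(5) by linarith
  then have k: "k \<ge> r" using r by simp
  show ?thesis
  \<comment> \<open>Without defect, single links suffice for any parts. In the other case
    \<open>d \<ge> 1\<close> forces \<open>r \<ge> 3\<close>, hence
    \<open>k \<ge> 3\<close>.\<close>
  proof (cases "d = 0 \<or> 1 \<notin># \<sigma>")
    case True
    have "a \<noteq> 1 \<and> b \<noteq> 1" if "1 \<notin># \<sigma>" using that \<sigma> by auto
    then have "\<beta> 0 \<ge> (if d = 0 then 1 else 2)" "\<beta> 1 \<ge> (if d = 0 then 1 else 2)"
      using True ab \<beta> by fastforce+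
    then show ?thesis
      using size k r \<open>d \<le> r - 2\<close>
      by (intro hamiltonian_by_double_links[OF _ _ _ sum total \<beta>(4,5)]) auto
  next
    case False
    then show ?thesis
      using size k r \<open>d \<le> r - 2\<close> a ab \<beta>
      by (intro hamiltonian_by_large_links[OF _ _ _ sum total \<beta>(4,5)]) auto
  qed
qed

end
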